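(* Let \(\vec G\) be a complete-convex oriented graph with underlying graph \(G\). If \(uv\notin E_G\) and \(u\) and \(v\) are the ends of a \(2\)-dipath in \(\vec G\), then both \(\vec G+uv\) (adding the arc from \(u\) to \(v\)) and \(\vec G+vu\) (adding the arc from \(v\) to \(u\)) are complete convex.
   Context: Oriented graphs: anti-symmetric digraphs without parallel arcs. A \(2\)-dipath \(u,x,v\) with centre \(x\): \(ux,xv\) arcs, \(u\ne x\ne v\). A vertex set \(S\) is convex if no vertex outside \(S\) is the centre of a \(2\)-dipath with both ends in \(S\); \(conv(S)\) is the smallest convex superset of \(S\). An oriented graph is complete convex if \(conv(\{u,v\})\) is the whole vertex set for every arc \(uv\). *)

theory Defs
  imports "Graph_Theory.Digraph_Component" "HOL.Hull"
begin

text \<open>The vertex set is not required to be finite. Arcs are pairs, so there are no parallel arcs.\<close>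

locale oriented_graph = pair_loopfree_digraph +
  assumes antisym_arcs: "antisym (parcs G)"

abbreviation underlying_graph :: "'a pair_pre_digraph \<Rightarrow> 'a pair_pre_digraph" where
  "underlying_graph G \<equiv> mk_symmetric (with_proj G)"

definition two_dipath :: "'a pair_pre_digraph \<Rightarrow> 'a \<Rightarrow> 'a \<Rightarrow> 'a \<Rightarrow> bool" where
  "two_dipath G u x v \<longleftrightarrow> (u, x) \<in> parcs G \<and> (x, v) \<in> parcs G \<and> u \<noteq> x \<and> x \<noteq> v"

definition dipath_convex :: "'a pair_pre_digraph \<Rightarrow> 'a set \<Rightarrow> bool" where
  "dipath_convex G S \<longleftrightarrow> S \<subseteq> pverts G \<and>
     \<not> (\<exists>x \<in> pverts G - S. \<exists>u \<in> S. \<exists>v \<in> S. two_dipath G u x v)"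

definition conv :: "'a pair_pre_digraph \<Rightarrow> 'a set \<Rightarrow> 'a set" where
  "conv G S = dipath_convex G hull S"

text \<open>For a set of vertices, \<^const>\<open>conv\<close> really is the smallest convex superset.\<close>

lemma
  assumes "S \<subseteq> pverts G"
  shows dipath_convex_conv: "dipath_convex G (conv G S)"
    and subset_conv: "S \<subseteq> conv G S"
    and conv_minimal: "dipath_convex G T \<Longrightarrow> S \<subseteq> T \<Longrightarrow> conv G S \<subseteq> T"
proof -
  have "dipath_convex G (pverts G)"
    by (simp add: dipath_convex_def)
  with assms have "conv G S \<subseteq> pverts G"
    unfolding conv_def by (rule hull_minimal)
  moreover have False
    if x: "x \<in> pverts G" "x \<notin> conv G S"
      and uv: "u \<in> conv G S" "v \<in> conv G S" and P: "two_dipath G u x v" for x u v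
  proof -
    from x(2) obtain T where T: "dipath_convex G T" "S \<subseteq> T" "x \<notin> T"
      unfolding conv_def hull_def by blast
    then have "conv G S \<subseteq> T"
      unfolding conv_def by (intro hull_minimal)
    then have "u \<in> T" "v \<in> T"
      using uv by auto
    with x(1) T(1,3) P show False
      unfolding dipath_convex_def by blast
  qed
  ultimately show "dipath_convex G (conv G S)"
    unfolding dipath_convex_def by blast
  show "S \<subseteq> conv G S"
    unfolding conv_def by (rule hull_subset)
  show "dipath_convex G T \<Longrightarrow> S \<subseteq> T \<Longrightarrow> conv G S \<subseteq> T"
    unfolding conv_def by (rule hull_minimal)
qed

locale complete_convex = oriented_graph +
  assumes conv_arc: "(u, v) \<in> parcs G \<Longrightarrow> conv G {u, v} = pverts G"

definition padd_arc :: "'a pair_pre_digraph \<Rightarrow> 'a \<times> 'a \<Rightarrow> 'a pair_pre_digraph" where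
  "padd_arc G a = \<lparr> pverts = pverts G \<union> {fst a, snd a}, parcs = insert a (parcs G) \<rparr>"

lemma with_proj_padd_arc: "with_proj (padd_arc G a) = pre_digraph.add_arc (with_proj G) a"
  by (simp add: padd_arc_def pre_digraph.add_arc_def with_proj_def)

end

theory Submission
  imports Defs
begin

text \<open>Adding an arc between existing vertices only adds \<open>2\<close>-dipaths, so a convex set of the larger
  graph is convex in the original one. Hence the hull of an old arc is still everything, and the hull
  of the new arc contains the centre \<open>x\<close> of the given \<open>2\<close>-dipath and with it an old arc.\<close>

lemma dipath_convex_padd_arcD:
  assumes "dipath_convex (padd_arc G (u, v)) S" "u \<in> pverts G" "v \<in> pverts G"
  shows "dipath_convex G S"
  using assms unfolding dipath_convex_def padd_arc_def two_dipath_def by auto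

lemma two_dipath_imp_mem:
  assumes "dipath_convex G S" "two_dipath G u x v" "x \<in> pverts G" "u \<in> S" "v \<in> S"
  shows "x \<in> S"
  using assms unfolding dipath_convex_def by blast

text \<open>By minimality of the hull, \<open>S\<close> contains \<open>conv G {a, b}\<close>, which
  is everything. Later steps can thus reason about arbitrary convex sets instead of hulls.\<close>

lemma (in complete_convex) dipath_convex_eq_pverts:
  assumes "dipath_convex G S" "(a, b) \<in> parcs G" "a \<in> S" "b \<in> S"
  shows "S = pverts G"
proof -
  have "conv G {a, b} \<subseteq> S"
    unfolding conv_def using assms by (intro hull_minimal) auto
  then show ?thesis
    using assms(1) conv_arc[OF assms(2)] by (auto simp: dipath_convex_def)
qed

text \<open>The direction of the dipath is left open so that exchanging \<open>u\<close> and
  \<open>v\<close> covers the opposite new arc.\<close>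

lemma (in complete_convex) complete_convex_padd_arc:
  assumes nonadj: "(u, v) \<notin> parcs G" "(v, u) \<notin> parcs G"
    and dipath: "two_dipath G u x v \<or> two_dipath G v x u"
  shows "complete_convex (padd_arc G (u, v))"
proof -
  let ?H = "padd_arc G (u, v)"
  have arcs_verts: "a \<in> pverts G \<and> b \<in> pverts G" if "(a, b) \<in> parcs G" for a b
    using wellformed[OF that] by simp
  have verts: "u \<in> pverts G" "v \<in> pverts G" "x \<in> pverts G"
    using dipath arcs_verts unfolding two_dipath_def by blast+
  \<comment> \<open>If \<open>u = v\<close>, the dipath would go from \<open>u\<close> to
    \<open>x\<close> and back, against antisymmetry.\<close>
  have "u \<noteq> v"
    using dipath antisym_arcs by (auto simp: two_dipath_def antisym_def)
  have pverts_H: "pverts ?H = pverts G"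
    using verts by (auto simp: padd_arc_def)
  have eq_pverts: "S = pverts G"
    if S: "dipath_convex ?H S" and ab: "(a, b) \<in> parcs ?H" "a \<in> S" "b \<in> S" for S a b
  proof -
    note convex = dipath_convex_padd_arcD[OF S verts(1,2)]
    show ?thesis
    proof (cases "(a, b) \<in> parcs G")
      case True
      then show ?thesis
        using dipath_convex_eq_pverts[OF convex] ab(2,3) by simp
    next
      case False
      with ab have uv: "u \<in> S" "v \<in> S"
        by (auto simp: padd_arc_def)
      have "x \<in> S"
        using dipath two_dipath_imp_mem[OF convex _ verts(3)] uv by metis
      \<comment> \<open>Whichever way the dipath runs, its arc between \<open>u\<close> and
        \<open>x\<close> is an old arc with both ends in \<open>S\<close>.\<close>
      moreover have "(u, x) \<in> parcs G \<or> (x, u) \<in> parcs G"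
        using dipath by (auto simp: two_dipath_def)
      ultimately show ?thesis
        using dipath_convex_eq_pverts[OF convex] uv(1) by metis
    qed
  qed
  have conv_H: "conv ?H {a, b} = pverts ?H" if "(a, b) \<in> parcs ?H" for a b
  proof -
    have ab: "{a, b} \<subseteq> pverts ?H"
      using that verts arcs_verts by (auto simp: padd_arc_def)
    \<comment> \<open>The hull is itself convex in \<open>?H\<close> and contains \<open>a\<close>
      and \<open>b\<close>, so it can serve as \<open>S\<close> in \<open>eq_pverts\<close>.\<close>
    show ?thesis
      unfolding pverts_H
      using eq_pverts[OF dipath_convex_conv[OF ab] that] subset_conv[OF ab] by simp
  qed
  show ?thesis
  proof
    show "fst e \<in> pverts ?H" "snd e \<in> pverts ?H" if "e \<in> parcs ?H" for e
      using that verts wellformed by (auto simp: padd_arc_def)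
    show "fst e \<noteq> snd e" if "e \<in> parcs ?H" for e
      using that \<open>u \<noteq> v\<close> no_loops by (auto simp: padd_arc_def)
    show "antisym (parcs ?H)"
    proof (rule antisymI)
      fix a b
      assume "(a, b) \<in> parcs ?H" "(b, a) \<in> parcs ?H"
      \<comment> \<open>The new arc is not the reverse of an old one; if both pairs are the new arc,
        then \<open>a = b\<close>.\<close>
      then have "(a, b) \<in> parcs G \<and> (b, a) \<in> parcs G \<or> a = b"
        using nonadj by (auto simp: padd_arc_def)
      then show "a = b"
        using antisymD[OF antisym_arcs] by metis
    qed
  qed (fact conv_H)
qed

theorem theorem11:
  fixes G :: "'a pair_pre_digraph" and u v :: 'a
  assumes "complete_convex G"
    and "(u, v) \<notin> parcs (underlying_graph G)"
    and "\<exists>x. two_dipath G u x v \<or> two_dipath G v x u"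
  shows "complete_convex (padd_arc G (u, v)) \<and> complete_convex (padd_arc G (v, u))"
proof -
  interpret complete_convex G by fact
  \<comment> \<open>The underlying graph is the symmetric closure, so a non-edge excludes both
    orientations.\<close>
  have nonadj: "(u, v) \<notin> parcs G" "(v, u) \<notin> parcs G"
    using assms(2) by (auto simp: parcs_mk_symmetric)
  obtain x where "two_dipath G u x v \<or> two_dipath G v x u"
    using assms(3) by (rule exE)
  then show ?thesis
    using complete_convex_padd_arc[of u v x] complete_convex_padd_arc[of v u x] nonadj by blast
qed

end
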